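(* For all integers $1\leq k\leq n$, the class $\mathcal{G}(n,k)$ of graphs with at most $n$ vertices and maximum degree at most $k$ admits an adjacency labeling scheme of size $\log\binom{n}{\lceil k/2\rceil} + \lceil \log n\rceil + \lceil \log k\rceil$.
   Context: All logarithms are base 2. An adjacency labeling scheme for a class $\mathcal{R}$ of graphs consists of an encoder and a decoder. The encoder receives a graph $G\in\mathcal{R}$ and assigns to each vertex $v\in V(G)$ a binary string (label) $\mathcal{L}(v)$. The decoder receives only two labels $\mathcal{L}(u),\mathcal{L}(v)$ of vertices of the same graph $G$ and must output \textbf{true} if and only if $u$ and $v$ are adjacent in $G$. The size of the scheme is the maximum label length (in bits). *)

theory Defs
  imports Complex_Main "Graph_Theory.Pair_Digraph"
begin

text \<open>
  A finite simple graph is a \<^locale>\<open>pair_graph\<close>, i.e. a finite, loop-free, symmetric digraph whose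
  arcs are pairs. Both orientations of an edge are arcs, so the out-degree of a vertex is its
  number of neighbours.
\<close>

definition bounded_degree_graphs :: "nat \<Rightarrow> nat \<Rightarrow> 'a pair_pre_digraph set" where
  "bounded_degree_graphs n k =
     {G. pair_graph G \<and> card (pverts G) \<le> n \<and>
         (\<forall>v \<in> pverts G. out_degree (with_proj G) v \<le> k)}"

type_synonym label = "bool list"
type_synonym 'a encoder = "'a pair_pre_digraph \<Rightarrow> 'a \<Rightarrow> label"
type_synonym decoder = "label \<Rightarrow> label \<Rightarrow> bool"

text \<open>
  The decoder is a single function for the whole class: it sees two labels, but not the graph.
\<close>

definition adjacency_labeling_scheme ::
    "'a pair_pre_digraph set \<Rightarrow> 'a encoder \<Rightarrow> decoder \<Rightarrow> bool" where
  "adjacency_labeling_scheme R enc dec \<longleftrightarrow>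
     (\<forall>G \<in> R. \<forall>u \<in> pverts G. \<forall>v \<in> pverts G.
        dec (enc G u) (enc G v) \<longleftrightarrow> u \<rightarrow>\<^bsub>with_proj G\<^esub> v)"

text \<open>
  The size of a scheme is the maximum label length over all vertices of all graphs of the class.
  The bound is a real number and is not rounded.
\<close>

definition labeling_size_at_most ::
    "'a pair_pre_digraph set \<Rightarrow> 'a encoder \<Rightarrow> real \<Rightarrow> bool" where
  "labeling_size_at_most R enc s \<longleftrightarrow>
     (\<forall>G \<in> R. \<forall>v \<in> pverts G. real (length (enc G v)) \<le> s)"

definition admits_adjacency_labeling_scheme ::
    "'a pair_pre_digraph set \<Rightarrow> real \<Rightarrow> bool" where
  "admits_adjacency_labeling_scheme R s \<longleftrightarrow>
     (\<exists>enc dec. adjacency_labeling_scheme R enc dec \<and> labeling_size_at_most R enc s)"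

end

theory Submission
  imports Defs "HOL-Library.Multiset"
begin

text \<open>
  The edges can be oriented so that in- and out-degree differ by at most one at every vertex, whence
  every vertex has at most \<open>h = \<lceil>k/2\<rceil>\<close> out-neighbours. A vertex is labelled by its number in
  \<open>{..<n}\<close> together with its set of out-neighbours, replaced by the vertex itself if it is empty.
  This is a nonempty set with at most \<open>h\<close> elements, and since \<open>h \<le> \<lceil>n/2\<rceil>\<close> there are at most
  \<open>h * (n choose h)\<close> of these. As labels may have different lengths, there are \<open>2 ^ (l + 1) - 1\<close>
  labels of length at most \<open>l\<close>, which makes up for the bit lost in rounding the size down.
\<close>

section \<open>Balanced orientations\<close>

abbreviation ends :: "'a \<times> 'a \<Rightarrow> 'a set" where
  "ends e \<equiv> {fst e, snd e}"

text \<open>Occurrences are split off rather than distinct elements, so \<open>x\<close> and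
  \<open>y\<close> may be two copies of one edge.\<close>

lemma size_filter_mset_ge_2E:
  assumes "2 \<le> size (filter_mset P N)"
  obtains x y N' where "N = add_mset x (add_mset y N')" "P x" "P y"
proof -
  obtain x A where x: "filter_mset P N = add_mset x A"
    using assms by (cases "filter_mset P N") auto
  then obtain y B where "A = add_mset y B"
    using assms by (cases A) auto
  with x have *: "filter_mset P N = add_mset x (add_mset y B)" by simp
  then have "add_mset x (add_mset y B) \<subseteq># N"
    by (metis multiset_filter_subset)
  then obtain N' where "N = add_mset x (add_mset y B) + N'"
    by (auto simp: mset_subset_eq_exists_conv)
  moreover have "P x" "P y"
    using * by (metis filter_mset_eq_conv union_single_eq_member multi_member_split
        insert_iff set_mset_add_mset_insert)+
  ultimately show thesis
    using that[of x y "B + N'"] by simp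
qed

text \<open>Induction on the number of edges: two edges that share a vertex are contracted to one.
  The contraction may create parallel edges and loops, hence multisets, and a loop has a singleton
  as its \<open>ends\<close>. Equal images under \<open>ends\<close> mean that \<open>N\<close>
  reorients \<open>M\<close>.\<close>

lemma balanced_orientation:
  fixes M :: "('a \<times> 'a) multiset"
  shows "\<exists>N. image_mset ends N = image_mset ends M \<and>
    (\<forall>v. \<bar>int (size {#e \<in># N. fst e = v#}) - int (size {#e \<in># N. snd e = v#})\<bar> \<le> 1)"
proof (induction "size M" arbitrary: M rule: less_induct)
  case less
  show ?case
  proof (cases "\<exists>a v b E. image_mset ends M = {#{a, v}, {v, b}#} + E")
    case True
    then obtain a v b E where M: "image_mset ends M = add_mset {a, v} (add_mset {v, b} E)"
      by auto
    then obtain e1 M1 where M1: "M = add_mset e1 M1" "image_mset ends M1 = add_mset {v, b} E"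
      by (metis (no_types, lifting) msed_map_invR)
    then obtain e2 M2 where M2: "M1 = add_mset e2 M2" "image_mset ends M2 = E"
      by (metis (no_types, lifting) msed_map_invR)
    txt \<open>Contract the path \<open>a, v, b\<close> to the edge \<open>{a, b}\<close> (a loop if \<open>a = b\<close>).\<close>
    have "size (add_mset (a, b) M2) < size M"
      using M1 M2 by simp
    from less.hyps[OF this] obtain N
      where N: "image_mset ends N = add_mset {a, b} E"
        and bal: "\<And>v. \<bar>int (size {#e \<in># N. fst e = v#}) - int (size {#e \<in># N. snd e = v#})\<bar> \<le> 1"
      using M2 by auto
    from N obtain e N' where e: "N = add_mset e N'" "ends e = {a, b}" "image_mset ends N' = E"
      by (metis (no_types, lifting) msed_map_invR)
    obtain c d where cd: "e = (c, d)" by (cases e)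
    with e have "c = a \<and> d = b \<or> c = b \<and> d = a"
      by (auto simp: doubleton_eq_iff)
    \<comment> \<open>The contracted edge comes back directed from \<open>c\<close> to
      \<open>d\<close> and is expanded to \<open>c\<close>, \<open>v\<close>, \<open>d\<close>. This
      keeps the counts contributed at \<open>c\<close> and \<open>d\<close> and adds one to both
      counts at \<open>v\<close>, so no difference changes.\<close>
    then have "image_mset ends (add_mset (c, v) (add_mset (v, d) N')) = image_mset ends M"
      using M e by (auto simp: insert_commute add_mset_commute)
    moreover have "\<bar>int (size {#e \<in># add_mset (c, v) (add_mset (v, d) N'). fst e = w#})
        - int (size {#e \<in># add_mset (c, v) (add_mset (v, d) N'). snd e = w#})\<bar> \<le> 1" for w
      using bal[of w] unfolding e(1) cd by (auto split: if_splits)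
    ultimately show ?thesis by blast
  next
    case False
    \<comment> \<open>With nothing left to contract, \<open>M\<close> itself works: two edges with a
      common tail, or a common head, would form a path, so both counts are 0 or 1.\<close>
    have fst: "size {#e \<in># M. fst e = v#} < 2" for v
    proof (rule ccontr)
      assume "\<not> ?thesis"
      then obtain x y N' where "M = add_mset x (add_mset y N')" "fst x = v" "fst y = v"
        using size_filter_mset_ge_2E[of "\<lambda>e. fst e = v" M thesis] unfolding not_less by blast
      then have "image_mset ends M = {#{snd x, v}, {v, snd y}#} + image_mset ends N'"
        by (simp add: insert_commute)
      with False show False by blast
    qed
    have snd: "size {#e \<in># M. snd e = v#} < 2" for v
    proof (rule ccontr)
      assume "\<not> ?thesis"
      then obtain x y N' where "M = add_mset x (add_mset y N')" "snd x = v" "snd y = v"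
        using size_filter_mset_ge_2E[of "\<lambda>e. snd e = v" M thesis] unfolding not_less by blast
      then have "image_mset ends M = {#{fst x, v}, {v, fst y}#} + image_mset ends N'"
        by (simp add: insert_commute)
      with False show False by blast
    qed
    have "\<bar>int (size {#e \<in># M. fst e = v#}) - int (size {#e \<in># M. snd e = v#})\<bar> \<le> 1" for v
      using fst[of v] snd[of v] by linarith
    then show ?thesis by blast
  qed
qed

text \<open>In a balanced orientation the out-degree exceeds the in-degree by at most one, while the
  two add up to at most \<open>k\<close>.\<close>

lemma (in pair_graph) orientation_out_degree_le:
  assumes deg: "\<And>v. v \<in> pverts G \<Longrightarrow> out_degree (with_proj G) v \<le> k"
  obtains D where "\<And>u v. (u, v) \<in> parcs G \<longleftrightarrow> (u, v) \<in> D \<or> (v, u) \<in> D"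
    and "\<And>v. finite (D `` {v})" and "\<And>v. card (D `` {v}) \<le> (k + 1) div 2"
proof -
  \<comment> \<open>As sets of endpoints, the two opposite arcs of an edge are counted once.\<close>
  define E where "E = ends ` parcs G"
  have fin: "finite E" unfolding E_def by simp
  have E_iff: "{u, v} \<in> E \<longleftrightarrow> (u, v) \<in> parcs G" for u v
  proof
    assume "{u, v} \<in> E"
    then obtain a b where "(a, b) \<in> parcs G" "{u, v} = {a, b}"
      unfolding E_def by auto
    then show "(u, v) \<in> parcs G"
      using arcs_symmetric by (auto simp: doubleton_eq_iff)
  next
    assume "(u, v) \<in> parcs G"
    then show "{u, v} \<in> E"
      unfolding E_def by (intro image_eqI[of _ _ "(u, v)"]) auto
  qed
  have "\<exists>M. image_mset ends M = mset_set E"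
  proof -
    have "\<forall>x\<in>E. \<exists>e. ends e = x" unfolding E_def by blast
    then obtain r where r: "\<And>x. x \<in> E \<Longrightarrow> ends (r x) = x" by metis
    have "image_mset ends (image_mset r (mset_set E)) = image_mset id (mset_set E)"
      unfolding image_mset.compositionality using r fin by (intro image_mset_cong) auto
    then show ?thesis by auto
  qed
  then obtain M :: "('a \<times> 'a) multiset" where "image_mset ends M = mset_set E" by blast
  with balanced_orientation[of M] obtain N
    where N: "image_mset ends N = mset_set E"
      and bal: "\<And>v. \<bar>int (size {#e \<in># N. fst e = v#}) - int (size {#e \<in># N. snd e = v#})\<bar> \<le> 1"
    by auto
  have set_N: "ends ` set_mset N = E"
    by (metis N fin finite_set_mset_mset_set set_image_mset)
  have N_arcs: "e \<in> parcs G" if "e \<in># N" for e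
    using that set_N E_iff[of "fst e" "snd e"] by auto
  have loopfree: "fst e \<noteq> snd e" if "e \<in># N" for e
    using N_arcs[OF that] no_loops' by (cases e) auto
  have "card (set_mset N `` {v}) \<le> (k + 1) div 2" for v
  proof -
    \<comment> \<open>Without loops, no edge at \<open>v\<close> is counted both as outgoing and as
      incoming.\<close>
    have "size {#e \<in># N. fst e = v#} + size {#e \<in># N. snd e = v#} = size {#e \<in># N. v \<in> ends e#}"
      using loopfree
    proof (induction N)
      case (add e N)
      then have "fst e \<noteq> snd e" by simp
      moreover have "size {#e \<in># N. fst e = v#} + size {#e \<in># N. snd e = v#}
          = size {#e \<in># N. v \<in> ends e#}"
        using add.prems by (intro add.IH) simp
      ultimately show ?case by auto
    qed simp
    also have "\<dots> = size {#x \<in># image_mset ends N. v \<in> x#}"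
      by (simp add: filter_mset_image_mset)
    also have "\<dots> = card {x \<in> E. v \<in> x}"
      using N fin by simp
    also have "\<dots> \<le> k"
    proof (cases "v \<in> pverts G")
      case True
      have "{x \<in> E. v \<in> x} \<subseteq> ends ` out_arcs (with_proj G) v"
      proof
        fix x assume "x \<in> {x \<in> E. v \<in> x}"
        then obtain a b where ab: "(a, b) \<in> parcs G" "x = {a, b}" "v = a \<or> v = b"
          unfolding E_def by auto
        then have "(b, a) \<in> parcs G" using arcs_symmetric by blast
        with ab show "x \<in> ends ` out_arcs (with_proj G) v"
          by (force simp: out_arcs_def)
      qed
      then have "card {x \<in> E. v \<in> x} \<le> card (out_arcs (with_proj G) v)"
        by (rule surj_card_le[rotated]) (rule finite_out_arcs)
      then show ?thesis
        using deg[OF True] by (simp add: out_degree_def)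
    next
      \<comment> \<open>The degree bound covers only vertices of \<open>G\<close>; other points have
        no incident edges.\<close>
      case False
      then have "{x \<in> E. v \<in> x} = {}"
        unfolding E_def by (auto dest: in_arcsD1 in_arcsD2)
      then show ?thesis by (metis card.empty le0)
    qed
    finally have "2 * size {#e \<in># N. fst e = v#} \<le> k + 1"
      using bal[of v] by linarith
    moreover have "card (set_mset N `` {v}) \<le> size {#e \<in># N. fst e = v#}"
    proof -
      have "set_mset N `` {v} = set_mset (image_mset snd {#e \<in># N. fst e = v#})"
        by force
      also have "card \<dots> \<le> size (image_mset snd {#e \<in># N. fst e = v#})"
        by (metis finite_set_mset mset_set_set_mset_msubset size_mset_mono size_mset_set)
      finally show ?thesis by simp
    qed
    ultimately show ?thesis by linarith
  qed
  moreover have "finite (set_mset N `` {v})" for v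
    by (rule finite_Image) simp
  moreover have "(u, v) \<in> parcs G \<longleftrightarrow> (u, v) \<in># N \<or> (v, u) \<in># N" for u v
  proof
    assume "(u, v) \<in> parcs G"
    then obtain e where e: "e \<in># N" "{u, v} = ends e"
      using E_iff[of u v] set_N by blast
    then have "e = (u, v) \<or> e = (v, u)"
      by (cases e) (auto simp: doubleton_eq_iff)
    with e show "(u, v) \<in># N \<or> (v, u) \<in># N" by auto
  qed (use N_arcs arcs_symmetric in blast)
  ultimately show thesis using that[of "set_mset N"] by blast
qed

section \<open>Counting subsets and bit strings\<close>

text \<open>Binomial coefficients increase up to the middle. The one other case is
  \<open>2 * h = n + 1\<close>, where \<open>h\<close> and \<open>h - 1\<close> are symmetric about
  the middle and give the same coefficient.\<close>

lemma choose_le_choose_half: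
  assumes "i \<le> h" "2 * h \<le> n + 1"
  shows "n choose i \<le> n choose h"
proof (cases "i = h \<or> 2 * h \<le> n")
  case True
  then show ?thesis using assms binomial_mono[of i h n] by auto
next
  case False
  then have "h = n - (h - 1)" "i \<le> h - 1" "2 * (h - 1) \<le> n" "h - 1 \<le> n"
    using assms by auto
  then show ?thesis
    by (metis binomial_mono binomial_symmetric)
qed

text \<open>Union bound over the sizes 1 to \<open>h\<close>. Leaving out the empty set gives
  \<open>h\<close> terms instead of \<open>h + 1\<close>, which matters for \<open>k = 1\<close>,
  where the final bound has factor \<open>k = h = 1\<close>.\<close>

lemma card_nonempty_subsets_le:
  assumes "2 * h \<le> n + 1"
  shows "card {S. S \<subseteq> {..<n} \<and> S \<noteq> {} \<and> card S \<le> h} \<le> h * (n choose h)"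
proof -
  have "{S. S \<subseteq> {..<n} \<and> S \<noteq> {} \<and> card S \<le> h} \<subseteq> (\<Union>i\<in>{1..h}. {S. S \<subseteq> {..<n} \<and> card S = i})"
    by (auto simp: Suc_le_eq card_gt_0_iff finite_subset[OF _ finite_lessThan])
  then have "card {S. S \<subseteq> {..<n} \<and> S \<noteq> {} \<and> card S \<le> h}
      \<le> card (\<Union>i\<in>{1..h}. {S. S \<subseteq> {..<n} \<and> card S = i})"
    by (intro card_mono finite_UN_I) auto
  also have "\<dots> \<le> (\<Sum>i\<in>{1..h}. card {S. S \<subseteq> {..<n} \<and> card S = i})"
    by (intro card_UN_le) simp
  also have "\<dots> = (\<Sum>i\<in>{1..h}. n choose i)"
    by (simp add: n_subsets)
  also have "\<dots> \<le> (\<Sum>i\<in>{1..h}. n choose h)"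
    using assms by (intro sum_mono choose_le_choose_half) auto
  finally show ?thesis by simp
qed

lemma card_bool_lists_length_le:
  "card {xs :: bool list. length xs \<le> l} = 2 ^ Suc l - 1"
proof -
  have "card {xs :: bool list. length xs \<le> l} = (\<Sum>i\<le>l. 2 ^ i)"
    using card_lists_length_le[of "UNIV :: bool set" l] by simp
  also have "\<dots> = 2 ^ Suc l - 1"
    by (induction l) auto
  finally show ?thesis .
qed

lemma ex_bool_list_encoding:
  assumes "finite A" "real (card A) \<le> 2 powr s" "0 \<le> s"
  obtains f :: "'a \<Rightarrow> bool list"
  where "inj_on f A" and "\<And>x. x \<in> A \<Longrightarrow> real (length (f x)) \<le> s"
proof -
  let ?l = "nat \<lfloor>s\<rfloor>"
  have "s < real (Suc ?l)" using assms(3) by linarith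
  then have "2 powr s < 2 powr real (Suc ?l)" by (intro powr_less_mono) auto
  then have "real (card A) < 2 powr real (Suc ?l)" using assms(2) by linarith
  also have "\<dots> = real (2 ^ Suc ?l)" by (subst powr_realpow) auto
  \<comment> \<open>The strict inequality between integers absorbs the missing one in
    \<open>2 ^ Suc ?l - 1\<close>.\<close>
  finally have "card A < 2 ^ Suc ?l" by (simp only: of_nat_less_iff)
  then have "card A \<le> card {xs :: bool list. length xs \<le> ?l}"
    unfolding card_bool_lists_length_le by linarith
  moreover have "finite {xs :: bool list. length xs \<le> ?l}"
    using finite_lists_length_le[of "UNIV :: bool set" ?l] by simp
  ultimately obtain f where f: "inj_on f A" "f ` A \<subseteq> {xs :: bool list. length xs \<le> ?l}"
    using inj_on_iff_card_le[OF assms(1)] by metis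
  have "real (length (f x)) \<le> s" if "x \<in> A" for x
  proof -
    have "length (f x) \<le> ?l" using f(2) that by auto
    with assms(3) show ?thesis by linarith
  qed
  with f(1) show thesis by (rule that)
qed

section \<open>Vertex codes and the labeling scheme\<close>

lemma (in pair_graph) vertex_codes:
  fixes n k :: nat
  assumes card: "card (pverts G) \<le> n"
    and deg: "\<And>v. v \<in> pverts G \<Longrightarrow> out_degree (with_proj G) v \<le> k" and k: "1 \<le> k"
  obtains f :: "'a \<Rightarrow> nat" and S :: "'a \<Rightarrow> nat set"
  where "\<And>v. v \<in> pverts G \<Longrightarrow> f v < n"
    and "\<And>v. v \<in> pverts G \<Longrightarrow> S v \<subseteq> {..<n} \<and> S v \<noteq> {} \<and> card (S v) \<le> (k + 1) div 2"
    and "\<And>u v. u \<in> pverts G \<Longrightarrow> v \<in> pverts G \<Longrightarrow>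
      (u, v) \<in> parcs G \<longleftrightarrow> f u \<noteq> f v \<and> (f v \<in> S u \<or> f u \<in> S v)"
proof -
  have "card (pverts G) \<le> card {..<n}" using card by simp
  then obtain f where f: "inj_on f (pverts G)" "f ` pverts G \<subseteq> {..<n}"
    using inj_on_iff_card_le[of "pverts G" "{..<n}"] by auto
  obtain D where D: "\<And>u v. (u, v) \<in> parcs G \<longleftrightarrow> (u, v) \<in> D \<or> (v, u) \<in> D"
    and fin: "\<And>v. finite (D `` {v})" and out: "\<And>v. card (D `` {v}) \<le> (k + 1) div 2"
    using orientation_out_degree_le[OF deg] by metis
  \<comment> \<open>The default \<open>{f v}\<close> has size 1, allowed since \<open>k\<close> is
    positive. It creates no false adjacency, as the test requires
    \<open>f u \<noteq> f v\<close>.\<close>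
  define S where "S v = (if D `` {v} = {} then {f v} else f ` (D `` {v}))" for v
  have D_verts: "D `` {v} \<subseteq> pverts G" for v
    using D by (auto dest: in_arcsD1 in_arcsD2)
  show thesis
  proof (rule that)
    show "f v < n" if "v \<in> pverts G" for v using f that by auto
    show "S v \<subseteq> {..<n} \<and> S v \<noteq> {} \<and> card (S v) \<le> (k + 1) div 2" if "v \<in> pverts G" for v
    proof (cases "D `` {v} = {}")
      case True
      then show ?thesis using f that k by (auto simp: S_def)
    next
      case False
      then have S: "S v = f ` (D `` {v})" by (simp add: S_def)
      have "S v \<subseteq> {..<n}" using D_verts[of v] f(2) unfolding S by blast
      moreover have "S v \<noteq> {}" using False unfolding S by blast
      moreover have "card (S v) \<le> (k + 1) div 2"
        using card_image_le[OF fin, of f v] out[of v] unfolding S by linarith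
      ultimately show ?thesis by blast
    qed
    \<comment> \<open>Injectivity of \<open>f\<close> makes membership of numbers reflect membership
      of vertices, and keeps \<open>f v\<close> out of the default set \<open>{f u}\<close>.\<close>
    have mem: "f v \<in> S u \<longleftrightarrow> (u, v) \<in> D"
      if "u \<in> pverts G" "v \<in> pverts G" "u \<noteq> v" for u v
    proof -
      have "f v \<in> f ` (D `` {u}) \<longleftrightarrow> v \<in> D `` {u}"
        using inj_on_image_mem_iff[OF f(1) that(2) D_verts] .
      moreover have "f u \<noteq> f v" using f(1) that by (auto dest: inj_onD)
      ultimately show ?thesis by (auto simp: S_def)
    qed
    show "(u, v) \<in> parcs G \<longleftrightarrow> f u \<noteq> f v \<and> (f v \<in> S u \<or> f u \<in> S v)"
      if "u \<in> pverts G" "v \<in> pverts G" for u v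
    proof (cases "u = v")
      case True
      then show ?thesis using no_loops' by auto
    next
      case False
      then have "f u \<noteq> f v" using f(1) that by (auto dest: inj_onD)
      then show ?thesis using False that mem D by auto
    qed
  qed
qed

theorem theorem3:
  fixes n k :: nat
  assumes "1 \<le> k" and "k \<le> n"
  shows "admits_adjacency_labeling_scheme
           (bounded_degree_graphs n k :: 'a pair_pre_digraph set)
           (log 2 (real (n choose nat \<lceil>real k / 2\<rceil>))
              + real_of_int \<lceil>log 2 (real n)\<rceil> + real_of_int \<lceil>log 2 (real k)\<rceil>)"
proof -
  define h where "h = (k + 1) div 2"
  have h: "nat \<lceil>real k / 2\<rceil> = h"
  proof -
    have "2 * h = k \<or> 2 * h = k + 1" unfolding h_def by presburger
    then have "\<lceil>real k / 2\<rceil> = int h" by (intro ceiling_unique) auto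
    then show ?thesis by simp
  qed
  have h_le: "h \<le> k" "h \<le> n" "2 * h \<le> n + 1" using assms by (auto simp: h_def)
  define s where "s = log 2 (real (n choose h)) + real_of_int \<lceil>log 2 (real n)\<rceil>
    + real_of_int \<lceil>log 2 (real k)\<rceil>"
  define F where "F = {S. S \<subseteq> {..<n} \<and> S \<noteq> {} \<and> card S \<le> h}"
  have C: "1 \<le> n choose h" using h_le by (simp add: Suc_le_eq)
  have "card ({..<n} \<times> F) \<le> n * (h * (n choose h))"
    using card_nonempty_subsets_le[OF h_le(3)] by (simp add: F_def card_cartesian_product)
  \<comment> \<open>Weakening the factor \<open>h\<close> to \<open>k\<close> matches the term
    \<open>log 2 k\<close> of the size; rounding the logarithms of \<open>n\<close> and
    \<open>k\<close> up only enlarges the exponent.\<close>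
  also have "\<dots> \<le> n * (k * (n choose h))" using h_le by simp
  finally have "real (card ({..<n} \<times> F)) \<le> real (n * (k * (n choose h)))"
    by (simp only: of_nat_le_iff)
  also have "\<dots> = 2 powr (log 2 n + (log 2 k + log 2 (n choose h)))"
    using assms C by (simp add: powr_add Suc_le_eq)
  also have "\<dots> \<le> 2 powr s"
    unfolding s_def by (intro powr_mono) (auto, linarith)
  finally have card_le: "real (card ({..<n} \<times> F)) \<le> 2 powr s" .
  have "0 \<le> log 2 n + (log 2 k + log 2 (n choose h))"
    using assms C h_le by (intro add_nonneg_nonneg) auto
  also have "\<dots> \<le> s" unfolding s_def by linarith
  finally have "0 \<le> s" .
  moreover have "finite ({..<n} \<times> F)" unfolding F_def by auto
  ultimately obtain code :: "nat \<times> nat set \<Rightarrow> bool list"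
    where inj: "inj_on code ({..<n} \<times> F)"
      and len: "\<And>x. x \<in> {..<n} \<times> F \<Longrightarrow> real (length (code x)) \<le> s"
    using ex_bool_list_encoding[OF _ card_le] by metis
  \<comment> \<open>The pairs may be chosen separately for each graph, but the map
    \<open>code\<close> from pairs to bit strings is fixed by \<open>n\<close> and \<open>k\<close>.
    Hence its inverse gives one decoder for the whole class.\<close>
  have "\<exists>fS. \<forall>u \<in> pverts G. fS u \<in> {..<n} \<times> F \<and>
      (\<forall>v \<in> pverts G. (u, v) \<in> parcs G \<longleftrightarrow>
        fst (fS u) \<noteq> fst (fS v) \<and> (fst (fS v) \<in> snd (fS u) \<or> fst (fS u) \<in> snd (fS v)))"
    if "G \<in> bounded_degree_graphs n k" for G :: "'a pair_pre_digraph"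
  proof -
    from that have "pair_graph G" and card: "card (pverts G) \<le> n"
      and deg: "\<And>v. v \<in> pverts G \<Longrightarrow> out_degree (with_proj G) v \<le> k"
      unfolding bounded_degree_graphs_def by auto
    interpret pair_graph G by fact
    obtain f S where "\<And>v. v \<in> pverts G \<Longrightarrow> f v < n"
      and "\<And>v. v \<in> pverts G \<Longrightarrow> S v \<subseteq> {..<n} \<and> S v \<noteq> {} \<and> card (S v) \<le> (k + 1) div 2"
      and "\<And>u v. u \<in> pverts G \<Longrightarrow> v \<in> pverts G \<Longrightarrow>
        (u, v) \<in> parcs G \<longleftrightarrow> f u \<noteq> f v \<and> (f v \<in> S u \<or> f u \<in> S v)"
      using vertex_codes[OF card deg assms(1)] by metis
    then show ?thesis
      by (intro exI[of _ "\<lambda>v. (f v, S v)"]) (auto simp: F_def h_def)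
  qed
  then obtain fS :: "'a pair_pre_digraph \<Rightarrow> 'a \<Rightarrow> nat \<times> nat set"
    where fS: "\<And>G u. G \<in> bounded_degree_graphs n k \<Longrightarrow> u \<in> pverts G \<Longrightarrow> fS G u \<in> {..<n} \<times> F"
      and adj: "\<And>G u v. G \<in> bounded_degree_graphs n k \<Longrightarrow> u \<in> pverts G \<Longrightarrow> v \<in> pverts G \<Longrightarrow>
        (u, v) \<in> parcs G \<longleftrightarrow> fst (fS G u) \<noteq> fst (fS G v) \<and>
          (fst (fS G v) \<in> snd (fS G u) \<or> fst (fS G u) \<in> snd (fS G v))"
    by metis
  define decode where "decode = inv_into ({..<n} \<times> F) code"
  define dec where "dec x y \<longleftrightarrow> fst (decode x) \<noteq> fst (decode y) \<and>
    (fst (decode y) \<in> snd (decode x) \<or> fst (decode x) \<in> snd (decode y))" for x y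
  have decode: "decode (code (fS G u)) = fS G u"
    if "G \<in> bounded_degree_graphs n k" "u \<in> pverts G" for G u
    unfolding decode_def using inv_into_f_f[OF inj fS[OF that]] .
  have "adjacency_labeling_scheme (bounded_degree_graphs n k) (\<lambda>G v. code (fS G v)) dec"
    unfolding adjacency_labeling_scheme_def dec_def by (simp add: decode adj)
  moreover have "labeling_size_at_most (bounded_degree_graphs n k) (\<lambda>G v. code (fS G v)) s"
    unfolding labeling_size_at_most_def using len fS by blast
  ultimately show ?thesis
    unfolding admits_adjacency_labeling_scheme_def h s_def by blast
qed

end
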